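(* Let $T$ be an oriented tree on $n\ge 2$ vertices $1,\dots,n$ with directed edges $e_1,\dots,e_{n-1}$, non-zero edge weights in $\mathbb{C}\setminus\mathbb{R}^-$, and complex signless incidence matrix $N$. Define the $(n-1)\times n$ matrix $B=(b_{ij})$ by $$b_{ij}=\frac{(-1)^{d(e_i,j)}}{n}\begin{cases}\dfrac{|T_h(e_i)|}{\sqrt{w_{uv}}}\,\dfrac{|wt(\gamma_{j\to u})|}{wt(\gamma_{j\to u})} & \text{if } j\in T_t(e_i),\\[2mm] \dfrac{|T_t(e_i)|}{\sqrt{\overline{w_{uv}}}}\,\dfrac{|wt(\gamma_{j\to v})|}{wt(\gamma_{j\to v})} & \text{if } j\in T_h(e_i),\end{cases}$$ where $e_i=(u,v)$. Then $B$ is the Moore--Penrose inverse of $N$.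
   Context: An oriented tree is a directed graph obtained from a finite undirected tree by giving each edge exactly one direction. Each directed edge $(u,v)$ (tail $u$, head $v$) has a non-zero complex weight $w_{uv}$. $\mathbb{R}^-$ denotes the negative real numbers and $\sqrt{\cdot}$ is the principal square root. The complex signless incidence matrix of $T$ is the $n\times(n-1)$ matrix $N=(n_{ij})$ where, for $e_j=(u,v)$, $n_{ij}=\sqrt{w_{uv}}$ if $i=u$, $n_{ij}=\sqrt{\overline{w_{uv}}}$ if $i=v$, and $n_{ij}=0$ otherwise. Put $a_{ij}=w_{ij}$ if $(i,j)\in E(T)$, $a_{ij}=\overline{w_{ji}}$ if $(j,i)\in E(T)$, and $a_{ij}=0$ otherwise. The weight of a walk $\gamma=(i_1,\dots,i_k)$ in the underlying tree is $wt(\gamma)=\prod_{s=1}^{k-1}a_{i_si_{s+1}}$ (so a trivial one-vertex walk has weight $1$), and $\gamma_{j\to u}$ is the unique walk without repeated vertices from $j$ to $u$. For an edge $e_i=(u,v)$: $T_t(e_i)$ and $T_h(e_i)$ are the connected components of $T-e_i$ containing the tail $u$ and the head $v$, respectively, and $|T_t(e_i)|,|T_h(e_i)|$ are their numbers of vertices; $d(e_i,j)=\min(d(u,j),d(v,j))$, where $d$ is the distance in the underlying tree. *)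

theory Defs
  imports
    "Graph_Theory.Graph_Theory"
    "Jordan_Normal_Form.Schur_Decomposition"
begin

section \<open>Oriented trees\<close>

text \<open>Undirected graphs are symmetric digraphs, as in the Graph-Theory library.\<close>

definition underlying_graph :: "('a, 'b) pre_digraph \<Rightarrow> ('a, 'a \<times> 'a) pre_digraph" where
  "underlying_graph T = with_proj (mk_symmetric T)"

text \<open>
  The library's \<^const>\<open>tree\<close> is not usable here: \<^const>\<open>forest\<close> excludes directed cycles
  only. On an oriented graph it thus admits undirected cycles such as the transitive triangle,
  and on a symmetric digraph it is violated by every edge, because \<open>u, v, u\<close> counts as a cycle.
  An undirected cycle is therefore required to have at least three distinct vertices.
\<close>

definition undirected_acyclic :: "('a, 'b) pre_digraph \<Rightarrow> bool" where
  "undirected_acyclic G \<longleftrightarrow>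
     \<not> (\<exists>p. vpath p G \<and> length p \<ge> 3 \<and> (last p, hd p) \<in> arcs_ends G)"

definition undirected_tree :: "('a, 'b) pre_digraph \<Rightarrow> bool" where
  "undirected_tree G \<longleftrightarrow>
     graph G \<and> Digraph_Component.connected G \<and> undirected_acyclic G"

definition oriented_tree :: "('a, 'b) pre_digraph \<Rightarrow> bool" where
  "oriented_tree T \<longleftrightarrow>
     digraph T \<and> undirected_tree (underlying_graph T) \<and>
     (\<forall>u v. u \<rightarrow>\<^bsub>T\<^esub> v \<longrightarrow> \<not> v \<rightarrow>\<^bsub>T\<^esub> u)"

definition graph_dist :: "('a, 'b) pre_digraph \<Rightarrow> 'a \<Rightarrow> 'a \<Rightarrow> nat" where
  "graph_dist T u v =
     (LEAST k. \<exists>p. vwalk p (underlying_graph T) \<and> hd p = u \<and> last p = v \<and> vwalk_length p = k)"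

definition edge_dist :: "('a, 'b) pre_digraph \<Rightarrow> 'b \<Rightarrow> 'a \<Rightarrow> nat" where
  "edge_dist T e j = min (graph_dist T (tail T e) j) (graph_dist T (head T e) j)"

text \<open>
  The vertex sets of the components of \<open>T - e\<close>; in a symmetric digraph the strongly
  connected components are the connected components.
\<close>

definition tail_component :: "('a, 'b) pre_digraph \<Rightarrow> 'b \<Rightarrow> 'a set" where
  "tail_component T e =
     pre_digraph.scc_of (underlying_graph (pre_digraph.del_arc T e)) (tail T e)"

definition head_component :: "('a, 'b) pre_digraph \<Rightarrow> 'b \<Rightarrow> 'a set" where
  "head_component T e =
     pre_digraph.scc_of (underlying_graph (pre_digraph.del_arc T e)) (head T e)"


section \<open>Weights\<close>

text \<open>Only the values \<open>w u v\<close> with \<open>(u, v)\<close> an edge of \<open>T\<close> are ever used.\<close>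

definition adj_weight ::
    "('a, 'b) pre_digraph \<Rightarrow> ('a \<Rightarrow> 'a \<Rightarrow> complex) \<Rightarrow> 'a \<Rightarrow> 'a \<Rightarrow> complex" where
  "adj_weight T w i j =
     (if i \<rightarrow>\<^bsub>T\<^esub> j then w i j else if j \<rightarrow>\<^bsub>T\<^esub> i then cnj (w j i) else 0)"

definition walk_weight ::
    "('a, 'b) pre_digraph \<Rightarrow> ('a \<Rightarrow> 'a \<Rightarrow> complex) \<Rightarrow> 'a vwalk \<Rightarrow> complex" where
  "walk_weight T w p = prod_list (map (\<lambda>(i, j). adj_weight T w i j) (vwalk_arcs p))"

definition tree_path :: "('a, 'b) pre_digraph \<Rightarrow> 'a \<Rightarrow> 'a \<Rightarrow> 'a vwalk" where
  "tree_path T j u = (THE p. vpath p (underlying_graph T) \<and> hd p = j \<and> last p = u)"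


section \<open>Matrices\<close>

text \<open>
  Matrix indices start at 0, so the vertices \<open>0, \<dots>, n - 1\<close> index the rows of the
  incidence matrix and the arcs \<open>0, \<dots>, n - 2\<close> index its columns.
\<close>

definition signless_incidence_mat ::
    "nat \<Rightarrow> (nat, nat) pre_digraph \<Rightarrow> (nat \<Rightarrow> nat \<Rightarrow> complex) \<Rightarrow> complex mat" where
  "signless_incidence_mat n T w = mat n (n - 1) (\<lambda>(i, j).
     let u = tail T j; v = head T j in
       if i = u then csqrt (w u v)
       else if i = v then csqrt (cnj (w u v))
       else 0)"

definition B_mat ::
    "nat \<Rightarrow> (nat, nat) pre_digraph \<Rightarrow> (nat \<Rightarrow> nat \<Rightarrow> complex) \<Rightarrow> complex mat" where
  "B_mat n T w = mat (n - 1) n (\<lambda>(i, j).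
     let u = tail T i; v = head T i;
         wt_u = walk_weight T w (tree_path T j u);
         wt_v = walk_weight T w (tree_path T j v)
     in (- 1) ^ edge_dist T i j / of_nat n *
        (if j \<in> tail_component T i then
           of_nat (card (head_component T i)) / csqrt (w u v) *
             (complex_of_real (cmod wt_u) / wt_u)
         else if j \<in> head_component T i then
           of_nat (card (tail_component T i)) / csqrt (cnj (w u v)) *
             (complex_of_real (cmod wt_v) / wt_v)
         else 0))"

definition moore_penrose_inverse :: "complex mat \<Rightarrow> complex mat \<Rightarrow> bool" where
  "moore_penrose_inverse A X \<longleftrightarrow>
     X \<in> carrier_mat (dim_col A) (dim_row A) \<and>
     A * X * A = A \<and>
     X * A * X = X \<and>
     mat_adjoint (A * X) = A * X \<and>
     mat_adjoint (X * A) = X * A"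

end

(* Let D be the sign (-1)^length times the phase of the weight of walks from a fixed root; in a tree
   it depends on the end point only. For e = (u, v) the choice of square roots gives
   D v * cnj (sqrt w) = - D u * sqrt w, so the unitary row scaling by D turns N into the oriented
   incidence matrix M with scaled columns. Likewise B is the classical inverse of M, whose entries
   are |T_h|/n and -|T_t|/n, with the scalings undone. Deleting an edge separates its end points but
   those of no other edge, hence B N = 1. The conjugate of D spans the kernel of B and of the
   adjoint of N, so N B is the orthogonal projection onto its complement. *)
theory Submission
  imports Defs
begin

section \<open>Moore--Penrose inverses in corank one\<close>

lemma mat_adjoint_index [simp]:
  fixes A :: "'a :: conjugatable_field mat"
  shows "i < dim_col A \<Longrightarrow> j < dim_row A \<Longrightarrow> mat_adjoint A $$ (i, j) = conjugate (A $$ (j, i))"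
    "dim_row (mat_adjoint A) = dim_col A" "dim_col (mat_adjoint A) = dim_row A"
  by (auto simp: mat_adjoint_def mat_of_rows_index conjugate_vec_def)

lemma mult_mat_index_sum:
  "\<lbrakk>A \<in> carrier_mat l m; B \<in> carrier_mat m n; i < l; j < n\<rbrakk>
    \<Longrightarrow> (A * B) $$ (i, j) = (\<Sum>k<m. A $$ (i, k) * B $$ (k, j))"
  by (auto simp: scalar_prod_def atLeast0LessThan intro!: sum.cong)

text \<open>
  Bordering \<open>A\<close> with the column \<open>z\<close> and \<open>X\<close> with the row \<open>z\<^sup>*\<close>, suitably scaled, turns the left
  inverse \<open>X\<close> into an inverse of square matrices, whence \<open>A X = 1 - z z\<^sup>* / (z\<^sup>* z)\<close>.
\<close>

lemma moore_penrose_inverseI_corank_one: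
  fixes z :: "nat \<Rightarrow> complex"
  assumes A: "A \<in> carrier_mat (Suc m) m" and X: "X \<in> carrier_mat m (Suc m)"
    and XA: "X * A = 1\<^sub>m m"
    and Xz: "\<And>i. i < m \<Longrightarrow> (\<Sum>j<Suc m. X $$ (i, j) * z j) = 0"
    and zA: "\<And>i. i < m \<Longrightarrow> (\<Sum>j<Suc m. cnj (z j) * A $$ (j, i)) = 0"
    and zz: "(\<Sum>j<Suc m. cnj (z j) * z j) \<noteq> 0"
  shows "moore_penrose_inverse A X"
proof -
  define r where "r = (\<Sum>j<Suc m. cnj (z j) * z j)"
  \<comment> \<open>Since r is real, the correction z_i \<open>cnj (z j)\<close> / r found below is
    Hermitian, and with it \<open>A * X\<close>.\<close>
  have r: "r \<noteq> 0" "cnj r = r" using zz by (auto simp: r_def mult.commute)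
  define A' where "A' = mat (Suc m) (Suc m) (\<lambda>(i, j). if j < m then A $$ (i, j) else z i / r)"
  define X' where "X' = mat (Suc m) (Suc m) (\<lambda>(i, j). if i < m then X $$ (i, j) else cnj (z j))"
  have c: "A' \<in> carrier_mat (Suc m) (Suc m)" "X' \<in> carrier_mat (Suc m) (Suc m)"
    by (auto simp: A'_def X'_def)
  have XA': "(\<Sum>k<Suc m. X $$ (i, k) * A $$ (k, j)) = (if i = j then 1 else 0)" if "i < m" "j < m" for i j
    using XA mult_mat_index_sum[OF X A that] that by simp
  have "X' * A' = 1\<^sub>m (Suc m)"
  proof (rule eq_matI)
    fix i j assume "i < dim_row (1\<^sub>m (Suc m) :: complex mat)" "j < dim_col (1\<^sub>m (Suc m) :: complex mat)"
    hence ij: "i < Suc m" "j < Suc m" by auto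
    have "(X' * A') $$ (i, j) = (\<Sum>k<Suc m. (if i < m then X $$ (i, k) else cnj (z k)) *
        (if j < m then A $$ (k, j) else z k / r))"
      unfolding mult_mat_index_sum[OF c(2,1) ij] using ij
      by (intro sum.cong) (auto simp: A'_def X'_def)
    also have "\<dots> = (if i = j then 1 else 0)"
    proof -
      have "(\<Sum>k<Suc m. X $$ (i, k) * (z k / r)) = 0" if "i < m"
        using Xz[OF that] by (simp del: sum.lessThan_Suc flip: sum_divide_distrib)
      moreover have "(\<Sum>k<Suc m. cnj (z k) * (z k / r)) = 1"
        using r by (simp add: r_def del: sum.lessThan_Suc flip: sum_divide_distrib)
      ultimately show ?thesis using XA' zA ij
        by (auto simp del: sum.lessThan_Suc simp: less_Suc_eq)
    qed
    finally show "(X' * A') $$ (i, j) = 1\<^sub>m (Suc m) $$ (i, j)" using ij by simp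
  qed (use c in auto)
  hence AX': "A' * X' = 1\<^sub>m (Suc m)" using mat_mult_left_right_inverse c by blast
  have AX: "(A * X) $$ (i, j) = (if i = j then 1 else 0) - z i * cnj (z j) / r"
    if ij: "i < Suc m" "j < Suc m" for i j
  proof -
    have "(A' * X') $$ (i, j) = (\<Sum>k<m. A $$ (i, k) * X $$ (k, j)) + z i * cnj (z j) / r"
      unfolding mult_mat_index_sum[OF c ij] using ij by (simp add: A'_def X'_def)
    thus ?thesis using AX' mult_mat_index_sum[OF A X ij] ij by auto
  qed
  have "mat_adjoint (A * X) = A * X"
    using A X r by (intro eq_matI) (auto simp: AX simp del: index_mult_mat(1))
  moreover have "mat_adjoint (X * A) = X * A"
    unfolding XA by (intro eq_matI) auto
  moreover have "A * X * A = A" "X * A * X = X"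
    using A X XA by (simp_all add: assoc_mult_mat[OF A X A])
  ultimately show ?thesis using A X by (simp add: moore_penrose_inverse_def)
qed

text \<open>A purely imaginary root would make z zero or a negative real. For every other admissible
  z the principal root lies in the open right half-plane; conjugation preserves that half-plane, and
  a root lying there is principal.\<close>

lemma csqrt_cnj:
  assumes "z \<notin> complex_of_real ` {..<0}"
  shows "csqrt (cnj z) = cnj (csqrt z)"
proof (cases "z = 0")
  case False
  have "Re (csqrt z) \<noteq> 0"
  proof
    assume "Re (csqrt z) = 0"
    hence "(csqrt z)\<^sup>2 = complex_of_real (- (Im (csqrt z))\<^sup>2)"
      by (simp add: complex_eq_iff power2_eq_square)
    hence "z = complex_of_real (- (Im (csqrt z))\<^sup>2)" by simp
    moreover from this False have "Im (csqrt z) \<noteq> 0" by auto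
    ultimately show False using assms by (metis imageI lessThan_iff neg_less_0_iff_less zero_less_power2)
  qed
  hence "0 < Re (cnj (csqrt z))" using csqrt_principal[of z] by auto
  thus ?thesis by (intro csqrt_unique) (auto simp flip: complex_cnj_power)
qed simp

section \<open>Potentials and distances in trees\<close>

definition walk_prod :: "('a \<Rightarrow> 'a \<Rightarrow> 'c::monoid_mult) \<Rightarrow> 'a list \<Rightarrow> 'c" where
  "walk_prod g p = prod_list (map (\<lambda>(x, y). g x y) (vwalk_arcs p))"

lemma walk_prod_simps [simp]:
  "walk_prod g [] = 1"
  "walk_prod g [x] = 1"
  "walk_prod g (x # y # p) = g x y * walk_prod g (y # p)"
  by (simp_all add: walk_prod_def)

lemma walk_prod_snoc: "p \<noteq> [] \<Longrightarrow> walk_prod g (p @ [x]) = walk_prod g p * g (last p) x"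
  by (simp add: walk_prod_def vwalk_arcs_append)

text \<open>\<open>sgn\<close> is multiplicative and each arc contributes one minus sign. This
  couples the two ingredients of an entry of B, the sign and the phase of the walk weight, in a
  single product.\<close>

lemma walk_prod_uminus_sgn:
  fixes f :: "'a \<Rightarrow> 'a \<Rightarrow> complex"
  shows "walk_prod (\<lambda>x y. - sgn (f x y)) p = (-1) ^ vwalk_length p * sgn (walk_prod f p)"
  by (induct p rule: vwalk_arcs.induct) (auto simp: sgn_mult)

lemma vwalk_snocI:
  "\<lbrakk>vwalk p G; x \<in> verts G; last p \<rightarrow>\<^bsub>G\<^esub> x\<rbrakk> \<Longrightarrow> vwalk (p @ [x]) G"
  unfolding vwalk_def by (auto simp: vwalk_arcs_append)

locale tree_graph =
  fixes G :: "('a, 'b) pre_digraph"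
  assumes tree: "undirected_tree G"

sublocale tree_graph \<subseteq> graph G
  using tree by (simp add: undirected_tree_def)

context tree_graph
begin

lemma adj_sym: "x \<rightarrow>\<^bsub>G\<^esub> y \<Longrightarrow> y \<rightarrow>\<^bsub>G\<^esub> x"
  by (rule arcs_ends_symmetric[OF sym_arcs])

lemma no_closing_arc: "vpath p G \<Longrightarrow> 3 \<le> length p \<Longrightarrow> \<not> last p \<rightarrow>\<^bsub>G\<^esub> hd p"
  using tree by (auto simp: undirected_tree_def undirected_acyclic_def)

lemma ex_vpath:
  assumes "x \<in> verts G" "y \<in> verts G"
  obtains p where "vpath p G" "hd p = x" "last p = y"
proof -
  have "Digraph_Component.connected G"
    using tree by (simp add: undirected_tree_def)
  hence "x \<rightarrow>\<^sup>*\<^bsub>with_proj (mk_symmetric G)\<^esub> y"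
    using assms by (auto simp: connected_def strongly_connected_def)
  \<comment> \<open>The graph is symmetric already, so the symmetrisation inside
    \<open>connected\<close> adds no adjacencies.\<close>
  moreover have "arcs_ends (with_proj (mk_symmetric G)) = arcs_ends G"
    using adj_sym by (auto simp: parcs_mk_symmetric arcs_ends_conv)
  ultimately have "x \<rightarrow>\<^sup>*\<^bsub>G\<^esub> y"
    by (simp add: reachable_def)
  thus ?thesis using that by (auto simp: reachable_vpath_conv)
qed

section \<open>Deleting an edge of a tree\<close>

definition cut :: "'a \<Rightarrow> 'a \<Rightarrow> ('a, 'a \<times> 'a) pre_digraph" where
  "cut a b = \<lparr>verts = verts G, arcs = arcs_ends G - {(a, b), (b, a)}, tail = fst, head = snd\<rparr>"

text \<open>For adjacent a and b this is the component of a after deletion of the edge ab. The arcs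
  of \<open>cut\<close> are vertex pairs so that it can later be equated with the underlying graph
  of \<open>del_arc e\<close>.\<close>

definition side :: "'a \<Rightarrow> 'a \<Rightarrow> 'a set" where
  "side a b = {j. a \<rightarrow>\<^sup>*\<^bsub>cut a b\<^esub> j}"

lemma verts_cut [simp]: "verts (cut a b) = verts G"
  by (simp add: cut_def)

lemma arcs_ends_cut [simp]: "arcs_ends (cut a b) = arcs_ends G - {(a, b), (b, a)}"
  by (auto simp: cut_def arcs_ends_conv)

lemma cut_commute: "cut b a = cut a b"
  by (auto simp: cut_def)

lemma sym_digraph_cut: "sym_digraph (cut a b)"
proof
  show "symmetric (cut a b)"
    unfolding symmetric_def arcs_ends_cut using adj_sym by (auto simp: sym_def)
qed (auto simp: cut_def dest: adj_in_verts)

lemma reachable_cut_sym: "x \<rightarrow>\<^sup>*\<^bsub>cut a b\<^esub> y \<Longrightarrow> y \<rightarrow>\<^sup>*\<^bsub>cut a b\<^esub> x"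
  using symmetric_reachable sym_digraph.sym_arcs[OF sym_digraph_cut] by fast

lemma reachable_cut_trans:
  "x \<rightarrow>\<^sup>*\<^bsub>cut a b\<^esub> y \<Longrightarrow> y \<rightarrow>\<^sup>*\<^bsub>cut a b\<^esub> z \<Longrightarrow> x \<rightarrow>\<^sup>*\<^bsub>cut a b\<^esub> z"
  by (rule wf_digraph.reachable_trans[OF sym_digraph.axioms(1)[OF sym_digraph_cut]])

lemma side_subset: "side a b \<subseteq> verts G"
  by (auto simp: side_def elim: reachable_in_vertsE)

text \<open>The direct arc is gone, so a simple path from a to b in the cut graph has an inner
  vertex. Together with the deleted edge it would close an undirected cycle on at least three
  vertices.\<close>

lemma not_reachable_cut:
  assumes "a \<rightarrow>\<^bsub>G\<^esub> b"
  shows "\<not> a \<rightarrow>\<^sup>*\<^bsub>cut a b\<^esub> b"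
proof
  interpret C: sym_digraph "cut a b" by (rule sym_digraph_cut)
  assume "a \<rightarrow>\<^sup>*\<^bsub>cut a b\<^esub> b"
  then obtain p where p: "vpath p (cut a b)" "hd p = a" "last p = b"
    by (auto simp: C.reachable_vpath_conv)
  have "a \<noteq> b" using assms adj_not_same by blast
  have pG: "vpath p G" using p(1) by (auto simp: vpath_def vwalk_def)
  obtain x q where x: "p = a # x # q"
    using p(2,3) \<open>a \<noteq> b\<close> pG by (cases p rule: vwalk_arcs.cases) (auto simp: vpath_def vwalk_def)
  have "q \<noteq> []" using x p by (auto simp: vpath_def)
  hence "3 \<le> length p" using x by (cases q) auto
  with no_closing_arc[OF pG] p assms adj_sym show False by auto
qed

lemma side_disjoint: "a \<rightarrow>\<^bsub>G\<^esub> b \<Longrightarrow> side a b \<inter> side b a = {}"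
  using not_reachable_cut[of a b] reachable_cut_sym[of a b b] reachable_cut_trans[of a b a _ b]
  by (auto simp: side_def cut_commute[of b a])

text \<open>An edge other than ab survives the deletion. Hence a walk can change sides only across
  ab.\<close>

lemma side_adj:
  assumes "x \<rightarrow>\<^bsub>G\<^esub> y" "{x, y} \<noteq> {a, b}" "x \<in> side a b"
  shows "y \<in> side a b"
proof -
  interpret C: sym_digraph "cut a b" by (rule sym_digraph_cut)
  show ?thesis using assms unfolding side_def by (auto intro: C.reachable_adj_trans)
qed

lemma self_in_side: "a \<in> verts G \<Longrightarrow> a \<in> side a b"
  by (simp add: side_def reachable_def)

text \<open>Follow a walk from a: a surviving edge stays on its side, and crossing ab ends in a or
  b, each of which lies in its own side.\<close>

lemma side_cover:
  assumes "a \<rightarrow>\<^bsub>G\<^esub> b"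
  shows "side a b \<union> side b a = verts G"
proof
  show "side a b \<union> side b a \<subseteq> verts G" using side_subset by auto
  show "verts G \<subseteq> side a b \<union> side b a"
  proof
    fix j assume "j \<in> verts G"
    have ab: "a \<in> verts G" "b \<in> verts G" using assms adj_in_verts by auto
    then obtain p where "vpath p G" "hd p = a" "last p = j"
      using ex_vpath \<open>j \<in> verts G\<close> by blast
    hence "a \<rightarrow>\<^sup>*\<^bsub>G\<^esub> j" by (auto simp: reachable_vpath_conv)
    thus "j \<in> side a b \<union> side b a"
    proof (induct rule: reachable_induct)
      case base
      then show ?case using self_in_side by auto
    next
      case (step x y)
      show ?case
      proof (cases "{x, y} = {a, b}")
        case True
        then show ?thesis using self_in_side ab by (auto simp: doubleton_eq_iff)
      next
        case False
        then show ?thesis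
          using step(2,3) side_adj[of x y a b] side_adj[of x y b a] by (auto simp: insert_commute)
      qed
    qed
  qed
qed

text \<open>Both deleted arcs end or start in a, so a walk that misses a survives the cut.\<close>

lemma reachable_cut_avoiding:
  assumes "vwalk p G" "a \<notin> set p"
  shows "hd p \<rightarrow>\<^sup>*\<^bsub>cut a b\<^esub> last p"
proof -
  interpret C: sym_digraph "cut a b" by (rule sym_digraph_cut)
  have "vwalk p (cut a b)"
    using assms by (auto simp: vwalk_def elim: in_set_vwalk_arcsE)
  thus ?thesis by (auto simp: C.reachable_vwalk_conv)
qed

text \<open>If the paths left x towards different vertices y and z, the edge xz and the two
  remaining paths, which avoid x, would still join x to y after deletion of the edge xy.\<close>

lemma vpath_unique:
  assumes "vpath p G" "vpath q G" "hd p = hd q" "last p = last q"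
  shows "p = q"
  using assms
proof (induct p arbitrary: q rule: vwalk_arcs.induct)
  case 1
  then show ?case by (simp add: vpath_def vwalk_def)
next
  case (2 x)
  then show ?case by (cases q rule: vwalk_arcs.cases) (auto simp: vpath_def vwalk_def split: if_splits)
next
  case (3 x y p)
  then obtain q1 where q1: "q = x # q1" by (cases q) (auto simp: vpath_def vwalk_def)
  have "last (y # p) \<in> set (y # p)" by (rule last_in_set) simp
  hence "last q \<noteq> x" using 3(2,5) by (auto simp: vpath_def)
  with q1 obtain z q2 where q: "q = x # z # q2"
    by (cases q1) auto
  have p': "vpath (y # p) G" and q': "vpath (z # q2) G" and xy: "x \<rightarrow>\<^bsub>G\<^esub> y" and xz: "x \<rightarrow>\<^bsub>G\<^esub> z"
    and nx: "x \<notin> set (y # p)" "x \<notin> set (z # q2)"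
    using 3(2,3) q by (auto simp: vpath_def)
  have lst: "last (y # p) = last (z # q2)" using 3(5) q by simp
  have "y = z"
  proof (rule ccontr)
    assume "y \<noteq> z"
    interpret C: sym_digraph "cut x y" by (rule sym_digraph_cut)
    have "x \<rightarrow>\<^bsub>cut x y\<^esub> z" using xz \<open>y \<noteq> z\<close> adj_not_same by auto
    moreover have "z \<rightarrow>\<^sup>*\<^bsub>cut x y\<^esub> last (y # p)"
      using reachable_cut_avoiding[of "z # q2" x y] q' nx lst by (auto simp: vpath_def)
    moreover have "y \<rightarrow>\<^sup>*\<^bsub>cut x y\<^esub> last (y # p)"
      using reachable_cut_avoiding[of "y # p" x y] p' nx by (auto simp: vpath_def)
    ultimately have "x \<rightarrow>\<^sup>*\<^bsub>cut x y\<^esub> y"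
      using C.adj_reachable_trans reachable_cut_trans[OF _ reachable_cut_sym] by blast
    with not_reachable_cut xy show False by blast
  qed
  with 3(1)[OF p' q'] lst q show ?case by simp
qed

section \<open>Paths from a root and potentials\<close>

definition path_between :: "'a \<Rightarrow> 'a \<Rightarrow> 'a list" where
  "path_between x y = (THE p. vpath p G \<and> hd p = x \<and> last p = y)"

lemma path_between_eqI: "\<lbrakk>vpath p G; hd p = x; last p = y\<rbrakk> \<Longrightarrow> path_between x y = p"
  unfolding path_between_def by (rule the_equality) (auto intro: vpath_unique)

lemma path_between:
  assumes "x \<in> verts G" "y \<in> verts G"
  shows "vpath (path_between x y) G" "hd (path_between x y) = x" "last (path_between x y) = y"
  using ex_vpath[OF assms] path_between_eqI by metis+

text \<open>If y is off the path to x, appending y gives the simple path to y. Otherwise truncating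
  that path at y and appending x gives a simple path to x, which by uniqueness is the original
  one.\<close>

lemma path_between_adj:
  assumes "r \<in> verts G" "x \<rightarrow>\<^bsub>G\<^esub> y"
  shows "path_between r y = path_between r x @ [y] \<or> path_between r x = path_between r y @ [x]"
proof -
  have xy: "x \<in> verts G" "y \<in> verts G" "x \<noteq> y"
    using assms adj_in_verts adj_not_same by auto
  define p where "p = path_between r x"
  have p: "vpath p G" "hd p = r" "last p = x"
    using path_between assms xy unfolding p_def by auto
  hence ne: "p \<noteq> []" by (auto simp: vpath_def)
  show ?thesis
  proof (cases "y \<in> set p")
    case False
    have "vpath (p @ [y]) G"
      using p False assms xy by (auto simp: vpath_def intro!: vwalk_snocI)
    thus ?thesis using path_between_eqI[of "p @ [y]" r y] p ne by (simp add: p_def)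
  next
    case True
    then obtain p1 p2 where split: "p = p1 @ y # p2" by (auto simp: in_set_conv_decomp)
    hence w: "vwalk (p1 @ [y]) G" using p(1) vwalkI_append_l[of "p1 @ [y]" p2 G]
      by (auto simp: vpath_def)
    have "x \<in> set p2" using split p(3) xy by (cases p2) auto
    hence "vpath (p1 @ [y]) G" "vpath ((p1 @ [y]) @ [x]) G"
      using w p(1) split assms xy adj_sym
      by (auto simp: vpath_def simp del: append_assoc intro!: vwalk_snocI)
    hence "path_between r y = p1 @ [y]" "path_between r x = (p1 @ [y]) @ [x]"
      using p(2) split by (auto intro!: path_between_eqI simp: hd_append)
    thus ?thesis by simp
  qed
qed

text \<open>Take D as the product of g along the path from a root. Of two adjacent vertices, one has
  its path extending the other's, and the hypothesis lets g be inverted when the edge is traversed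
  backwards.\<close>

lemma ex_potential:
  fixes g :: "'a \<Rightarrow> 'a \<Rightarrow> 'c::field"
  assumes g: "\<And>x y. x \<rightarrow>\<^bsub>G\<^esub> y \<Longrightarrow> g x y * g y x = 1"
  obtains D where "\<And>x. x \<in> verts G \<Longrightarrow> D x \<noteq> 0" "\<And>x y. x \<rightarrow>\<^bsub>G\<^esub> y \<Longrightarrow> D y = D x * g x y"
proof (cases "verts G = {}")
  case True
  thus ?thesis using that adj_in_verts by blast
next
  case False
  then obtain r where r: "r \<in> verts G" by auto
  define D where "D x = walk_prod g (path_between r x)" for x
  have nz: "walk_prod g p \<noteq> 0" if "vwalk p G" for p
    using that by induct (use g in force)+
  show ?thesis
  proof
    show "D x \<noteq> 0" if "x \<in> verts G" for x
      using nz path_between[OF r that] by (auto simp: D_def vpath_def)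
    fix x y assume xy: "x \<rightarrow>\<^bsub>G\<^esub> y"
    hence V: "x \<in> verts G" "y \<in> verts G" using adj_in_verts by auto
    note X = path_between[OF r V(1)] and Y = path_between[OF r V(2)]
    have ne: "path_between r x \<noteq> []" "path_between r y \<noteq> []"
      using X Y by (auto simp: vpath_def)
    from path_between_adj[OF r xy] show "D y = D x * g x y"
    proof
      assume "path_between r y = path_between r x @ [y]"
      thus ?thesis using X(3) ne by (simp add: D_def walk_prod_snoc)
    next
      assume "path_between r x = path_between r y @ [x]"
      hence "D x = D y * g y x" using Y(3) ne by (simp add: D_def walk_prod_snoc)
      thus ?thesis using g[OF adj_sym[OF xy]] by (simp add: mult.assoc)
    qed
  qed
qed

lemma potential_walk_prod:
  fixes D :: "'a \<Rightarrow> 'c::comm_monoid_mult"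
  assumes "\<And>x y. x \<rightarrow>\<^bsub>G\<^esub> y \<Longrightarrow> D y = D x * g x y" and "vwalk p G"
  shows "D (last p) = D (hd p) * walk_prod g p"
  using assms(2) by induct (use assms(1) in \<open>auto simp: mult.assoc\<close>)

text \<open>A potential for the constant \<open>-1\<close> is a bipartition of the tree.\<close>

lemma parity_walk_length:
  assumes "vwalk p G" "vwalk q G" "hd p = hd q" "last p = last q"
  shows "(-1 :: complex) ^ vwalk_length p = (-1) ^ vwalk_length q"
proof -
  obtain D :: "'a \<Rightarrow> complex" where D: "\<And>x. x \<in> verts G \<Longrightarrow> D x \<noteq> 0"
      "\<And>x y. x \<rightarrow>\<^bsub>G\<^esub> y \<Longrightarrow> D y = D x * (-1)"
    using ex_potential[of "\<lambda>_ _. -1"] by auto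
  have "walk_prod (\<lambda>_ _. -1) r = (-1 :: complex) ^ vwalk_length r" for r :: "'a list"
    by (induct r rule: vwalk_arcs.induct) auto
  hence "D (last r) = D (hd r) * (-1) ^ vwalk_length r" if "vwalk r G" for r
    using potential_walk_prod[of D "\<lambda>_ _. -1", OF D(2) that] by simp
  from this[OF assms(1)] this[OF assms(2)] show ?thesis
    using assms D(1)[of "hd q"] by (auto simp: vwalk_def subset_iff)
qed

section \<open>Distances and phases across an edge\<close>

definition vdist :: "'a \<Rightarrow> 'a \<Rightarrow> nat" where
  "vdist x y = (LEAST k. \<exists>p. vwalk p G \<and> hd p = x \<and> last p = y \<and> vwalk_length p = k)"

lemma vdist_walk:
  assumes "x \<in> verts G" "y \<in> verts G"
  obtains p where "vwalk p G" "hd p = x" "last p = y" "vwalk_length p = vdist x y"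
proof -
  have "\<exists>k p. vwalk p G \<and> hd p = x \<and> last p = y \<and> vwalk_length p = k"
    using path_between[OF assms] by (auto simp: vpath_def)
  from LeastI_ex[OF this] show ?thesis using that unfolding vdist_def by blast
qed

lemma vdist_le: "\<lbrakk>vwalk p G; hd p = x; last p = y\<rbrakk> \<Longrightarrow> vdist x y \<le> vwalk_length p"
  unfolding vdist_def by (rule Least_le) blast

text \<open>The side can be entered only across ab, that is, at a. What remains of the walk after
  the entry starts at a and is shorter by at least one arc.\<close>

lemma walk_into_side:
  assumes "vwalk p G" "hd p \<notin> side a b" "last p \<in> side a b" "a \<rightarrow>\<^bsub>G\<^esub> b"
  shows "vdist a (last p) < vwalk_length p"
  using assms
proof (induct p rule: vwalk_arcs.induct)
  case (3 x y p)
  hence w: "vwalk (y # p) G" and xy: "x \<rightarrow>\<^bsub>G\<^esub> y" by auto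
  show ?case
  proof (cases "y \<in> side a b")
    case True
    have "{x, y} = {a, b}"
      using side_adj[OF adj_sym[OF xy], of a b] True 3(3) by (auto simp: insert_commute)
    hence "y = a"
      using 3(3) self_in_side adj_in_verts[OF xy] by (auto simp: doubleton_eq_iff)
    thus ?thesis using vdist_le[OF w, of a "last (y # p)"] by simp
  next
    case False
    thus ?thesis using 3 w by fastforce
  qed
qed auto

text \<open>A shortest walk from b to j has to enter the side of a. So the minimum in
  \<open>edge_dist\<close> is attained at the end of the edge on the side of j.\<close>

lemma vdist_less:
  assumes "a \<rightarrow>\<^bsub>G\<^esub> b" "j \<in> side a b"
  shows "vdist a j < vdist b j"
proof -
  have V: "b \<in> verts G" "j \<in> verts G" using assms adj_in_verts side_subset[of a b] by auto
  then obtain p where p: "vwalk p G" "hd p = b" "last p = j" "vwalk_length p = vdist b j"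
    using vdist_walk by blast
  have "b \<notin> side a b" using side_disjoint[OF assms(1)] self_in_side V by blast
  thus ?thesis using walk_into_side[OF p(1), of a b] p assms by simp
qed

text \<open>The minimum is the length of a shortest walk from a to j; reversed, it has the same ends
  as p, hence the same parity.\<close>

lemma parity_edge_dist:
  assumes "a \<rightarrow>\<^bsub>G\<^esub> b" "j \<in> side a b" "vwalk p G" "hd p = j" "last p = a"
  shows "(-1 :: complex) ^ min (vdist a j) (vdist b j) = (-1) ^ vwalk_length p"
proof -
  have V: "a \<in> verts G" "j \<in> verts G" using assms adj_in_verts side_subset[of a b] by auto
  then obtain q where q: "vwalk q G" "hd q = a" "last q = j" "vwalk_length q = vdist a j"
    using vdist_walk by blast
  have "q \<noteq> []" using q(1) by auto
  hence "(-1 :: complex) ^ vwalk_length (rev q) = (-1) ^ vwalk_length p"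
    using assms(3-5) q vwalk_rev_ex[OF sym_arcs q(1)]
    by (intro parity_walk_length) (auto simp: hd_rev last_rev)
  thus ?thesis using q(4) vdist_less[OF assms(1,2)] by simp
qed

text \<open>Along the path from j to a the potential picks up the sign (-1)^length and the phase
  \<open>sgn wt\<close>. The sign is its own inverse and |wt| / wt inverts the phase, so the path
  drops out of the entries of B.\<close>

lemma potential_phase:
  assumes D: "\<And>x. x \<in> verts G \<Longrightarrow> D x \<noteq> 0" "\<And>x y. x \<rightarrow>\<^bsub>G\<^esub> y \<Longrightarrow> D y = D x * - sgn (f x y)"
    and ab: "a \<rightarrow>\<^bsub>G\<^esub> b" "j \<in> side a b"
    and wt: "wt = walk_prod f (path_between j a)"
  shows "(-1) ^ min (vdist a j) (vdist b j) * (complex_of_real (cmod wt) / wt) = D j / D a"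
proof -
  have V: "a \<in> verts G" "j \<in> verts G" using ab adj_in_verts side_subset[of a b] by auto
  define p where "p = path_between j a"
  have p: "vwalk p G" "hd p = j" "last p = a"
    using path_between[OF V(2,1)] by (auto simp: p_def vpath_def)
  have "D a = D j * walk_prod (\<lambda>x y. - sgn (f x y)) p"
    using potential_walk_prod[of D "\<lambda>x y. - sgn (f x y)" p] D(2) p by simp
  hence Da: "D a = D j * ((-1) ^ vwalk_length p * sgn wt)"
    by (simp only: walk_prod_uminus_sgn wt p_def)
  \<comment> \<open>As \<open>sgn 0 = 0\<close>, a vanishing path weight would force
    \<open>D a = 0\<close>.\<close>
  with D(1)[OF V(1)] have "wt \<noteq> 0" by auto
  hence "complex_of_real (cmod wt) / wt = 1 / sgn wt" by (simp add: sgn_eq)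
  moreover have "sgn wt \<noteq> 0" using \<open>wt \<noteq> 0\<close> by (simp add: sgn_zero_iff)
  ultimately show ?thesis
    unfolding parity_edge_dist[OF ab p] Da using D(1)[OF V(2)]
    by (simp add: field_simps flip: power_mult_distrib)
qed

end

section \<open>Oriented trees\<close>

lemma arcs_ends_underlying_graph:
  "x \<rightarrow>\<^bsub>underlying_graph T\<^esub> y \<longleftrightarrow> x \<rightarrow>\<^bsub>T\<^esub> y \<or> y \<rightarrow>\<^bsub>T\<^esub> x"
  by (auto simp: underlying_graph_def parcs_mk_symmetric arcs_ends_conv)

lemma verts_underlying_graph [simp]: "verts (underlying_graph T) = verts T"
  by (simp add: underlying_graph_def)

locale oriented_tree_graph =
  fixes T :: "('a, 'b) pre_digraph"
  assumes oriented: "oriented_tree T"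

sublocale oriented_tree_graph \<subseteq> digraph T
  using oriented by (simp add: oriented_tree_def)

sublocale oriented_tree_graph \<subseteq> U: tree_graph "underlying_graph T"
  using oriented by unfold_locales (simp add: oriented_tree_def)

context oriented_tree_graph
begin

lemma adj_asym: "x \<rightarrow>\<^bsub>T\<^esub> y \<Longrightarrow> \<not> y \<rightarrow>\<^bsub>T\<^esub> x"
  using oriented by (simp add: oriented_tree_def)

lemma arc_adj: "e \<in> arcs T \<Longrightarrow> tail T e \<rightarrow>\<^bsub>T\<^esub> head T e"
  by (auto simp: arcs_ends_conv)

lemma arc_adj_underlying: "e \<in> arcs T \<Longrightarrow> tail T e \<rightarrow>\<^bsub>underlying_graph T\<^esub> head T e"
  by (simp add: arcs_ends_underlying_graph arc_adj)

text \<open>Asymmetry makes both arcs point the same way, and parallel arcs are excluded. Hence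
  deleting one arc of T deletes a whole undirected edge.\<close>

lemma underlying_edge_arc_unique:
  assumes "e \<in> arcs T" "f \<in> arcs T" "{tail T e, head T e} = {tail T f, head T f}"
  shows "e = f"
  using assms adj_asym[of "tail T e" "head T e"] arc_adj[of e] arc_adj[of f] no_multi_arcs[of e f]
  by (auto simp: doubleton_eq_iff arc_to_ends_def)

lemma underlying_del_arc:
  assumes e: "e \<in> arcs T"
  shows "underlying_graph (del_arc e) = U.cut (tail T e) (head T e)"
proof -
  have "parcs (mk_symmetric (del_arc e))
      = arcs_ends (underlying_graph T) - {(tail T e, head T e), (head T e, tail T e)}"
    using underlying_edge_arc_unique[OF e]
    by (fastforce simp: parcs_mk_symmetric underlying_graph_def)
  thus ?thesis
    by (simp add: U.cut_def underlying_graph_def[of "del_arc e"])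
qed

text \<open>\<open>scc_of\<close> asks for reachability in both directions; in the symmetric cut
  graph one direction gives the other.\<close>

lemma component_eq_side:
  assumes "e \<in> arcs T"
  shows "tail_component T e = U.side (tail T e) (head T e)"
    and "head_component T e = U.side (head T e) (tail T e)"
  using U.reachable_cut_sym
  unfolding tail_component_def head_component_def underlying_del_arc[OF assms] U.side_def
    pre_digraph.scc_of_def U.cut_commute[of "head T e"]
  by auto

lemma edge_dist_eq: "edge_dist T e j = min (U.vdist (tail T e) j) (U.vdist (head T e) j)"
  by (simp add: edge_dist_def graph_dist_def U.vdist_def)

lemma tree_path_eq: "tree_path T x y = U.path_between x y"
  by (simp add: tree_path_def U.path_between_def)

text \<open>Opposite directions of an edge carry conjugate weights, whose product is positive; so
  their phases are mutually inverse and a potential for the negated phases exists.\<close>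

lemma ex_gauge:
  assumes w: "\<And>u v. u \<rightarrow>\<^bsub>T\<^esub> v \<Longrightarrow> w u v \<noteq> 0"
  obtains D :: "'a \<Rightarrow> complex" where "\<And>x. x \<in> verts T \<Longrightarrow> cmod (D x) = 1"
    "\<And>x y. x \<rightarrow>\<^bsub>underlying_graph T\<^esub> y \<Longrightarrow> D y = D x * - sgn (adj_weight T w x y)"
proof -
  let ?g = "\<lambda>x y. - sgn (adj_weight T w x y)"
  have nz: "adj_weight T w x y \<noteq> 0" if "x \<rightarrow>\<^bsub>underlying_graph T\<^esub> y" for x y
    using that w by (auto simp: adj_weight_def arcs_ends_underlying_graph)
  have "?g x y * ?g y x = 1" if "x \<rightarrow>\<^bsub>underlying_graph T\<^esub> y" for x y
  proof -
    have "adj_weight T w y x = cnj (adj_weight T w x y)"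
      using that adj_asym by (auto simp: adj_weight_def arcs_ends_underlying_graph)
    hence "adj_weight T w x y * adj_weight T w y x = complex_of_real ((cmod (adj_weight T w x y))\<^sup>2)"
      by (simp only: complex_norm_square)
    hence "sgn (adj_weight T w x y * adj_weight T w y x) = 1"
      using nz[OF that] by (simp add: power2_eq_square sgn_mult sgn_of_real)
    thus ?thesis by (simp add: sgn_mult)
  qed
  then obtain D where D: "\<And>x. x \<in> verts T \<Longrightarrow> D x \<noteq> 0"
      "\<And>x y. x \<rightarrow>\<^bsub>underlying_graph T\<^esub> y \<Longrightarrow> D y = D x * ?g x y"
    using U.ex_potential[of ?g] by auto
  show ?thesis
  proof
    \<comment> \<open>Normalising D keeps the recursion, because its factors already have modulus
      1.\<close>
    show "cmod (sgn (D x)) = 1" if "x \<in> verts T" for x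
      using D(1)[OF that] by (simp add: norm_sgn)
    show "sgn (D y) = sgn (D x) * ?g x y" if "x \<rightarrow>\<^bsub>underlying_graph T\<^esub> y" for x y
      using D(2)[OF that] by (simp add: sgn_mult sgn_minus)
  qed
qed

end

section \<open>The incidence matrix and its inverse in the gauge\<close>

theorem theorem3p2:
  fixes n :: nat
    and T :: "(nat, nat) pre_digraph"
    and w :: "nat \<Rightarrow> nat \<Rightarrow> complex"
  assumes "n \<ge> 2"
    and "oriented_tree T"
    and "verts T = {0..<n}"
    and "arcs T = {0..<n - 1}"
    and "\<And>u v. u \<rightarrow>\<^bsub>T\<^esub> v \<Longrightarrow> w u v \<noteq> 0"
    and "\<And>u v. u \<rightarrow>\<^bsub>T\<^esub> v \<Longrightarrow> w u v \<notin> complex_of_real ` {..<0}"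
  shows "moore_penrose_inverse (signless_incidence_mat n T w) (B_mat n T w)"
proof -
  interpret oriented_tree_graph T by unfold_locales (rule assms(2))
  obtain m where m: "n = Suc m" using assms(1) by (cases n) auto
  obtain D where D: "\<And>x. x \<in> verts T \<Longrightarrow> cmod (D x) = 1"
      "\<And>x y. x \<rightarrow>\<^bsub>underlying_graph T\<^esub> y \<Longrightarrow> D y = D x * - sgn (adj_weight T w x y)"
    using ex_gauge assms(5) by blast
  have D0: "D x \<noteq> 0" if "x \<in> verts T" for x using D(1)[OF that] by auto
  have D1: "D x * cnj (D x) = 1" if "x \<in> verts T" for x
    using D(1)[OF that] by (simp flip: complex_norm_square)
  define s where "s i = csqrt (w (tail T i) (head T i))" for i
  define u where "u = tail T"
  define v where "v = head T"
  define St where "St i = U.side (u i) (v i)" for i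
  define Sh where "Sh i = U.side (v i) (u i)" for i
  let ?N = "signless_incidence_mat n T w" and ?B = "B_mat n T w"
  have arc: "u i \<in> verts T" "v i \<in> verts T" "u i \<noteq> v i" "u i \<rightarrow>\<^bsub>T\<^esub> v i" "i \<in> arcs T"
    "u i \<rightarrow>\<^bsub>underlying_graph T\<^esub> v i" "v i \<rightarrow>\<^bsub>underlying_graph T\<^esub> u i" if "i < m" for i
    using that m assms(4) arc_adj arc_adj_underlying U.adj_sym no_loops
    by (auto simp: u_def v_def)
  have s0: "s i \<noteq> 0" and cs: "csqrt (cnj (w (u i) (v i))) = cnj (s i)"
    and Dv: "D (v i) * cnj (s i) = - (D (u i) * s i)" if "i < m" for i
  proof -
    show s0: "s i \<noteq> 0" using assms(5) arc[OF that] by (simp add: s_def u_def v_def)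
    show "csqrt (cnj (w (u i) (v i))) = cnj (s i)"
      using csqrt_cnj assms(6) arc[OF that] by (simp add: s_def u_def v_def)
    \<comment> \<open>The weight is the square of s, so the recursion for D involves the squared
      phase of s; multiplying by \<open>cnj (s i)\<close> turns it back into s itself.\<close>
    have "w (u i) (v i) = (s i)\<^sup>2" by (simp add: s_def u_def v_def)
    hence "D (v i) = D (u i) * - (sgn (s i))\<^sup>2"
      using D(2)[OF arc(6)[OF that]] arc(4)[OF that]
      by (simp add: adj_weight_def sgn_mult power2_eq_square)
    moreover have "sgn (s i) * cnj (s i) = of_real (cmod (s i))"
      using s0 by (simp add: sgn_eq complex_norm_square[symmetric] power2_eq_square)
    moreover have "sgn (s i) * of_real (cmod (s i)) = s i"
      using s0 by (simp add: sgn_eq)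
    ultimately show "D (v i) * cnj (s i) = - (D (u i) * s i)"
      by (simp add: power2_eq_square mult.assoc)
  qed
  have cover: "St i \<union> Sh i = {..<Suc m}" "St i \<inter> Sh i = {}" if "i < m" for i
    using U.side_cover[OF arc(6)] U.side_disjoint[OF arc(6)] that m assms(3)
    by (auto simp: St_def Sh_def)
  have cards: "card (St i) + card (Sh i) = n" if "i < m" for i
    using cover[OF that] m by (metis card_Un_disjoint card_lessThan finite_Un finite_lessThan)
  have uv_side: "u i \<in> St i" "v i \<notin> St i" if "i < m" for i
    using that arc U.self_in_side cover by (force simp: St_def Sh_def)+
  \<comment> \<open>Row i of B is \<open>k i\<close> times the row with entries D_j h_ij:
    \<open>k i\<close> undoes the scaling of column i of N, and h / n is the classical inverse of
    the oriented incidence matrix.\<close>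
  define k where "k i = 1 / (D (u i) * s i * of_nat n)" for i
  define h :: "nat \<Rightarrow> nat \<Rightarrow> complex" where
    "h i j = (if j \<in> St i then of_nat (card (Sh i)) else - of_nat (card (St i)))" for i j
  have N: "?N $$ (j, i) = (if j = u i then s i else if j = v i then cnj (s i) else 0)"
    if "i < m" "j < Suc m" for i j
    using that m cs[OF that(1)]
    by (simp add: signless_incidence_mat_def Let_def u_def v_def s_def)
  \<comment> \<open>After row scaling by D, column i is a multiple of a column of the oriented
    incidence matrix.\<close>
  have DN: "D j * ?N $$ (j, i) = D (u i) * s i * ((if j = u i then 1 else 0) - (if j = v i then 1 else 0))"
    if "i < m" "j < Suc m" for i j
    using N[OF that] Dv[OF that(1)] arc(3)[OF that(1)] by auto
  have B: "?B $$ (i, j) = k i * D j * h i j" if ij: "i < m" "j < Suc m" for i j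
  proof -
    note comp = component_eq_side[OF arc(5)[OF ij(1)], folded u_def v_def, folded St_def Sh_def]
    show ?thesis
    proof (cases "j \<in> St i")
      case True
      let ?wt = "walk_weight T w (tree_path T j (u i))"
      have "(-1) ^ edge_dist T i j * (complex_of_real (cmod ?wt) / ?wt) = D j / D (u i)"
        using U.potential_phase[of D "adj_weight T w" "u i" "v i" j ?wt] D0 D(2) arc(6)[OF ij(1)] True
        by (simp add: edge_dist_eq tree_path_eq walk_weight_def walk_prod_def St_def u_def v_def)
      moreover have "?B $$ (i, j) = (-1) ^ edge_dist T i j * (complex_of_real (cmod ?wt) / ?wt)
          * (of_nat (card (Sh i)) / (of_nat n * s i))"
        using ij m True comp
        by (simp add: B_mat_def Let_def s_def mult_ac flip: u_def v_def)
      ultimately show ?thesis using True by (simp add: k_def h_def)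
    next
      case False
      let ?wt = "walk_weight T w (tree_path T j (v i))"
      have j: "j \<in> Sh i" using cover[OF ij(1)] False ij by auto
      have "(-1) ^ edge_dist T i j * (complex_of_real (cmod ?wt) / ?wt) = D j / D (v i)"
        using U.potential_phase[of D "adj_weight T w" "v i" "u i" j ?wt] D0 D(2) arc(7)[OF ij(1)] j
        by (simp add: edge_dist_eq tree_path_eq walk_weight_def walk_prod_def Sh_def u_def v_def
            min.commute)
      moreover have "?B $$ (i, j) = (-1) ^ edge_dist T i j * (complex_of_real (cmod ?wt) / ?wt)
          * (of_nat (card (St i)) / (of_nat n * cnj (s i)))"
        using ij m False j comp cs[OF ij(1)]
        by (simp add: B_mat_def Let_def mult_ac flip: u_def v_def)
      \<comment> \<open>The denominator contains exactly the product rewritten by \<open>Dv\<close>;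
        the minus sign this produces is the one in the second case of h.\<close>
      ultimately have "?B $$ (i, j) = D j * of_nat (card (St i)) / (of_nat n * (D (v i) * cnj (s i)))"
        by simp
      thus ?thesis unfolding Dv[OF ij(1)] using False by (simp add: k_def h_def)
    qed
  qed
  \<comment> \<open>Edge j survives the deletion of edge i, so both its ends lie on one
    side.\<close>
  have h_adj: "h i (u j) = h i (v j)" if "i < m" "j < m" "i \<noteq> j" for i j
  proof -
    have "{u j, v j} \<noteq> {u i, v i}"
      using underlying_edge_arc_unique[of j i] arc(5) that by (auto simp: u_def v_def)
    hence "u j \<in> St i \<longleftrightarrow> v j \<in> St i"
      using U.side_adj[of "u j" "v j" "u i" "v i"] U.side_adj[of "v j" "u j" "u i" "v i"]
        arc(6,7)[OF that(2)] by (auto simp: St_def insert_commute)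
    thus ?thesis by (simp add: h_def)
  qed
  have V: "j \<in> verts T \<longleftrightarrow> j < Suc m" for j using assms(3) m by auto
  show ?thesis
  \<comment> \<open>The conjugate of D serves as z: against B its entries cancel the factors D_j,
    and against N its conjugate D exposes columns with entries that sum to zero.\<close>
  proof (rule moore_penrose_inverseI_corank_one[where m = m and z = "\<lambda>j. cnj (D j)"])
    show A: "?N \<in> carrier_mat (Suc m) m" "?B \<in> carrier_mat m (Suc m)"
      by (auto simp: signless_incidence_mat_def B_mat_def m)
    show "?B * ?N = 1\<^sub>m m"
    proof (rule eq_matI)
      fix i j assume "i < dim_row (1\<^sub>m m :: complex mat)" "j < dim_col (1\<^sub>m m :: complex mat)"
      hence ij: "i < m" "j < m" by auto
      have "(?B * ?N) $$ (i, j) = (\<Sum>l<Suc m. k i * h i l * (D l * ?N $$ (l, j)))"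
        unfolding mult_mat_index_sum[OF A(2,1) ij] using B ij by (intro sum.cong) auto
      also have "\<dots> = (\<Sum>l<Suc m. k i * D (u j) * s j *
          ((if l = u j then h i l else 0) - (if l = v j then h i l else 0)))"
        using DN ij by (intro sum.cong) auto
      also have "\<dots> = k i * D (u j) * s j * (h i (u j) - h i (v j))"
        using arc(1,2)[OF ij(2)] V
        by (simp add: sum_subtractf del: sum.lessThan_Suc flip: sum_distrib_left)
      also have "\<dots> = (if i = j then 1 else 0)"
      proof (cases "i = j")
        case True
        \<comment> \<open>Edge i has its ends on opposite sides, so the difference is |T_h| + |T_t|,
          which cancels the n in \<open>k i\<close>.\<close>
        have "h i (u i) - h i (v i) = of_nat n"
          using uv_side[OF ij(1)] cards[OF ij(1)] by (auto simp: h_def simp flip: of_nat_add)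
        thus ?thesis using True s0[OF ij(1)] D0 arc(1)[OF ij(1)] assms(1) by (simp add: k_def)
      qed (use h_adj ij in simp)
      finally show "(?B * ?N) $$ (i, j) = 1\<^sub>m m $$ (i, j)" using ij by simp
    qed (use A in auto)
    show "(\<Sum>j<Suc m. ?B $$ (i, j) * cnj (D j)) = 0" if i: "i < m" for i
    proof -
      \<comment> \<open>With D gone, the sides contribute |T_t||T_h| and -|T_h||T_t|.\<close>
      have "(\<Sum>j<Suc m. ?B $$ (i, j) * cnj (D j)) = (\<Sum>j\<in>St i \<union> Sh i. k i * h i j)"
        unfolding cover(1)[OF i] using B[OF i] D1 V by (intro sum.cong) (auto simp: ac_simps)
      also have "\<dots> = k i * (sum (h i) (St i) + sum (h i) (Sh i))"
        using cover[OF i] by (subst sum.union_disjoint)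
          (auto simp: distrib_left sum_distrib_left intro: finite_subset[of _ "{..<Suc m}"])
      also have "sum (h i) (St i) = of_nat (card (St i)) * of_nat (card (Sh i))"
        by (simp add: h_def)
      also have "sum (h i) (Sh i) = (\<Sum>j\<in>Sh i. - of_nat (card (St i)))"
        using cover(2)[OF i] by (intro sum.cong) (auto simp: h_def)
      finally show ?thesis by simp
    qed
    show "(\<Sum>j<Suc m. cnj (cnj (D j)) * ?N $$ (j, i)) = 0" if i: "i < m" for i
    proof -
      have "(\<Sum>j<Suc m. cnj (cnj (D j)) * ?N $$ (j, i)) = (\<Sum>j<Suc m. D (u i) * s i *
          ((if j = u i then 1 else 0) - (if j = v i then 1 else 0)))"
        using DN[OF i] by (intro sum.cong) auto
      also have "\<dots> = 0"
        using arc(1,2)[OF i] V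
        by (simp add: sum_subtractf del: sum.lessThan_Suc flip: sum_distrib_left)
      finally show ?thesis .
    qed
    have "(\<Sum>j<Suc m. cnj (cnj (D j)) * cnj (D j)) = (\<Sum>j<Suc m. 1)"
      using D1 V by (intro sum.cong) auto
    thus "(\<Sum>j<Suc m. cnj (cnj (D j)) * cnj (D j)) \<noteq> 0"
      by (simp del: sum.lessThan_Suc of_nat_Suc)
  qed
qed

end
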